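(* Let $n\ge 1$, let $z\in\mathbb{C}^n_1$, let $\Delta\in\mathbb{C}^{n\times n}$ be Hermitian, and let $C=zz^*+\Delta$. Suppose that all diagonal entries of $C$ are nonnegative, that $\|\Delta\|_{\mathrm{op}}\le\frac{1}{14}n^{2/3}$, and that $\|\Delta z\|_\infty\le\frac{1}{14}n^{2/3}\sqrt{\log n}$. Then every second-order critical point of the problem $\max_{x\in\mathbb{C}^n_1}x^*Cx$ is a global optimum of that problem, and the global optimum is unique up to phase (i.e., if $x,y$ are global optima, then $x=ye^{i\theta}$ for some $\theta\in\mathbb{R}$).
   Context: $\mathbb{C}^n_1=\{x\in\mathbb{C}^n:|x_1|=\cdots=|x_n|=1\}$. $\|\cdot\|_{\mathrm{op}}$ is the operator norm (largest singular value), $\|\cdot\|_\infty$ the max-norm of a vector, $*$ the conjugate transpose, $\log$ the natural logarithm, and $\langle u,w\rangle=\Re\{u^*w\}$ on $\mathbb{C}^n$. For $x\in\mathbb{C}^n_1$, let $S(x)=\Re\{\mathrm{ddiag}(Cxx^* )\}-C$, where $\mathrm{ddiag}$ sets all off-diagonal entries of a matrix to zero; thus $S(x)$ is the Hermitian matrix obtained by subtracting $C$ from the diagonal matrix with entries $\Re\{(Cx)_i\bar x_i\}$. A point $x\in\mathbb{C}^n_1$ is a second-order critical point of $\max_{x\in\mathbb{C}^n_1}x^*Cx$ if $S(x)x=0$ and $\langle\dot x,S(x)\dot x\rangle\ge0$ for all $\dot x\in \mathrm{T}_x\mathbb{C}^n_1=\{\dot x\in\mathbb{C}^n:\Re\{\dot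 x_i\bar x_i\}=0\text{ for all }i\}$. *)

theory Defs
  imports "HOL-Analysis.Analysis"
begin

definition torus :: "(complex ^ 'n) set"
  where "torus = {x. \<forall>i. cmod (x $ i) = 1}"

definition ctranspose :: "complex ^ 'n ^ 'm \<Rightarrow> complex ^ 'm ^ 'n"
  where "ctranspose A = (\<chi> i j. cnj (A $ j $ i))"

definition hermitian :: "complex ^ 'n ^ 'n \<Rightarrow> bool"
  where "hermitian A \<longleftrightarrow> ctranspose A = A"

(* outer u w is the matrix u w\<^sup>*, and cinner u w the scalar u\<^sup>* w. *)
definition outer :: "complex ^ 'm \<Rightarrow> complex ^ 'n \<Rightarrow> complex ^ 'n ^ 'm"
  where "outer u w = (\<chi> i j. u $ i * cnj (w $ j))"

definition cinner :: "complex ^ 'n \<Rightarrow> complex ^ 'n \<Rightarrow> complex"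
  where "cinner u w = (\<Sum>i\<in>UNIV. cnj (u $ i) * w $ i)"

(* The real inner product Re (u\<^sup>* w) is the library inner product of this type. *)
lemma inner_eq_Re_cinner: "u \<bullet> w = Re (cinner u w)" for u w :: "complex ^ 'n"
  by (simp add: inner_vec_def cinner_def inner_complex_def)

(* The library's infnorm is not the right notion here: on complex vectors it takes the
   maximum over real and imaginary parts separately. *)
definition max_norm :: "complex ^ 'n \<Rightarrow> real"
  where "max_norm v = Max (range (\<lambda>i. cmod (v $ i)))"

definition ddiag :: "complex ^ 'n ^ 'n \<Rightarrow> complex ^ 'n ^ 'n"
  where "ddiag A = (\<chi> i j. if i = j then A $ i $ j else 0)"

definition Re_mat :: "complex ^ 'n ^ 'm \<Rightarrow> complex ^ 'n ^ 'm"
  where "Re_mat A = (\<chi> i j. complex_of_real (Re (A $ i $ j)))"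

definition S_mat :: "complex ^ 'n ^ 'n \<Rightarrow> complex ^ 'n \<Rightarrow> complex ^ 'n ^ 'n"
  where "S_mat C x = Re_mat (ddiag (C ** outer x x)) - C"

lemma S_mat_nth:
  "S_mat C x $ i $ j =
    (if i = j then complex_of_real (Re ((C *v x) $ i * cnj (x $ i))) else 0) - C $ i $ j"
proof -
  have "(C ** outer x x) $ i $ i = (C *v x) $ i * cnj (x $ i)"
    by (simp only: outer_def matrix_matrix_mult_def matrix_vector_mult_def vec_lambda_beta
        sum_distrib_right mult.assoc)
  then show ?thesis
    by (cases "i = j")
      (simp_all only: S_mat_def Re_mat_def ddiag_def vec_lambda_beta vector_minus_component
        if_True if_False simp_thms zero_complex.sel of_real_0)
qed

definition tangent_space :: "complex ^ 'n \<Rightarrow> (complex ^ 'n) set"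
  where "tangent_space x = {v. \<forall>i. Re (v $ i * cnj (x $ i)) = 0}"

definition second_order_critical :: "complex ^ 'n ^ 'n \<Rightarrow> complex ^ 'n \<Rightarrow> bool"
  where "second_order_critical C x \<longleftrightarrow>
    x \<in> torus \<and> S_mat C x *v x = 0 \<and> (\<forall>v\<in>tangent_space x. 0 \<le> v \<bullet> (S_mat C x *v v))"

(* For Hermitian C the value x\<^sup>* C x is real, so taking the real part only changes the type. *)
definition objective :: "complex ^ 'n ^ 'n \<Rightarrow> complex ^ 'n \<Rightarrow> real"
  where "objective C x = Re (cinner x (C *v x))"

lemma cinner_hermitian_real:
  assumes "hermitian C"
  shows "cinner x (C *v x) = complex_of_real (objective C x)"
proof -
  have C: "cnj (C $ i $ j) = C $ j $ i" for i j
  proof -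
    have "ctranspose C $ j $ i = C $ j $ i"
      using assms by (simp only: hermitian_def)
    then show ?thesis
      by (simp only: ctranspose_def vec_lambda_beta)
  qed
  have "cnj (cinner x (C *v x)) = (\<Sum>i\<in>UNIV. \<Sum>j\<in>UNIV. x $ i * (C $ j $ i * cnj (x $ j)))"
    by (simp only: cinner_def matrix_vector_mult_def vec_lambda_beta sum_distrib_left cnj_sum
        complex_cnj_mult complex_cnj_cnj C)
  also have "\<dots> = (\<Sum>j\<in>UNIV. \<Sum>i\<in>UNIV. x $ i * (C $ j $ i * cnj (x $ j)))"
    by (rule sum.swap)
  also have "\<dots> = cinner x (C *v x)"
    by (simp only: cinner_def matrix_vector_mult_def vec_lambda_beta sum_distrib_left mult_ac)
  finally show ?thesis
    by (metis Reals_cnj_iff objective_def of_real_Re)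
qed

definition global_optimum :: "complex ^ 'n ^ 'n \<Rightarrow> complex ^ 'n \<Rightarrow> bool"
  where "global_optimum C x \<longleftrightarrow> x \<in> torus \<and> (\<forall>y\<in>torus. objective C y \<le> objective C x)"

end

theory Submission
  imports Defs
begin

text \<open>
The matrix \<open>S = S_mat C x\<close> is a dual certificate for the problem.  Its quadratic form
at any point \<open>y\<close> of the torus equals the gap \<open>x\<^sup>* C x - y\<^sup>* C y\<close>.  At a point
with \<open>S x = 0\<close>, it therefore suffices to show that \<open>S\<close> is positive definite on the
complex orthogonal complement of \<open>x\<close>: then no gap is negative, and the gap vanishes only
for multiples of \<open>x\<close>.  This gives optimality and uniqueness up to phase at once
(\<open>strict_certificate\<close>).

Write \<open>n\<close> for the dimension, \<open>m = |z\<^sup>* x|\<close> for the correlation with the signal, and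
\<open>K\<close> for a bound on the operator norm of \<open>\<Delta>\<close>.  Suppose that \<open>S x = 0\<close>, that all numbers
\<open>l\<^sub>i = Re ((C x)\<^sub>i cnj x\<^sub>i)\<close> are nonnegative and that \<open>m\<close> is at least \<open>n/2\<close>.  Rotate the
phase of \<open>z\<close> so that \<open>z\<^sup>* x = m\<close>.  Then
\<open>l\<^sub>i x\<^sub>i = m z\<^sub>i + (\<Delta> x)\<^sub>i\<close>, so \<open>x\<^sub>i\<close> is nearly the phase of \<open>m z\<^sub>i\<close>; hence
\<open>m |x\<^sub>i - z\<^sub>i| \<le> 2 |(\<Delta> x)\<^sub>i|\<close>, and summing squares gives
\<open>\<parallel>x - z\<parallel> \<le> 4 K / sqrt n\<close>.  So \<open>m = n - \<parallel>x - z\<parallel>\<^sup>2/2\<close> is in fact close to \<open>n\<close>, and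
splitting \<open>\<Delta> x = \<Delta> z + \<Delta> (x - z)\<close> bounds the entries of \<open>\<Delta> x\<close>.  Each
\<open>l\<^sub>i \<ge> m - |(\<Delta> x)\<^sub>i|\<close> is then a large fraction of \<open>n\<close>.  For \<open>u\<close> orthogonal to
\<open>x\<close> the terms working against positivity are small: \<open>z\<^sup>* u = (z - x)\<^sup>* u\<close> is controlled
by \<open>\<parallel>x - z\<parallel>\<close>, and \<open>u\<^sup>* \<Delta> u\<close> by \<open>K\<close> (\<open>first_order_imp_certificate\<close>).

It remains to verify \<open>m \<ge> n/2\<close>, which is where points that are merely of first order fail.
For a second-order critical point, let \<open>p\<close> be the torus point obtained by reflecting every
\<open>z\<^sub>i\<close> in the real line through \<open>x\<^sub>i\<close>.  Then \<open>z - p\<close> and \<open>\<i> (z + p)\<close> are tangent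
vectors at \<open>x\<close>, and adding the two second-order conditions yields
\<open>z\<^sup>* C z + p\<^sup>* C p \<le> 2 x\<^sup>* C x\<close> (\<open>second_order_critical_two_point\<close>).  As the
first term is about \<open>n\<^sup>2\<close> and the second is essentially nonnegative, \<open>m\<^sup>2\<close> is at least
about \<open>n\<^sup>2/2\<close>.  A global optimum satisfies even \<open>z\<^sup>* C z \<le> x\<^sup>* C x\<close>, and optimality in
each coordinate separately provides the first-order conditions
(\<open>global_optimum_first_order\<close>).  The diagonal of \<open>C\<close> being nonnegative makes all
\<open>l\<^sub>i\<close> nonnegative in both cases.
\<close>

section \<open>The complex inner product\<close>

lemma cinner_diff_left: "cinner (v - w) u = cinner v u - cinner w u"
  by (simp add: cinner_def algebra_simps sum_subtractf)

lemma cinner_diff_right: "cinner u (v - w) = cinner u v - cinner u w"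
  by (simp add: cinner_def algebra_simps sum_subtractf)

lemma cinner_scale_left: "cinner (c *s u) w = cnj c * cinner u w"
  by (simp add: cinner_def sum_distrib_left mult_ac)

lemma cinner_scale_right: "cinner u (c *s w) = c * cinner u w"
  by (simp add: cinner_def sum_distrib_left mult_ac)

lemma cinner_commute: "cinner w u = cnj (cinner u w)"
  by (simp add: cinner_def cnj_sum mult_ac)

lemma cinner_Cauchy_Schwarz: "cmod (cinner u w) \<le> norm u * norm w"
proof -
  have "cmod (cinner u w) \<le> (\<Sum>i\<in>UNIV. \<bar>cmod (u $ i)\<bar> * \<bar>cmod (w $ i)\<bar>)"
    unfolding cinner_def by (rule order_trans[OF norm_sum]) (simp add: norm_mult)
  also have "\<dots> \<le> norm u * norm w"
    unfolding norm_vec_def by (rule L2_set_mult_ineq)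
  finally show ?thesis .
qed

lemma outer_mult_vec: "outer u w *v v = cinner w v *s u"
  by (simp add: vec_eq_iff outer_def cinner_def matrix_vector_mult_def sum_distrib_left mult_ac)

lemma inner_outer: "v \<bullet> (outer z z *v v) = (cmod (cinner z v))\<^sup>2"
proof -
  have "cinner v (outer z z *v v) = cinner z v * cnj (cinner z v)"
    by (simp only: outer_mult_vec cinner_scale_right cinner_commute[of v z])
  then show ?thesis
    by (simp only: inner_eq_Re_cinner complex_norm_square[symmetric] Re_complex_of_real)
qed

lemma objective_inner: "objective C x = x \<bullet> (C *v x)"
  by (simp add: objective_def inner_eq_Re_cinner)

lemma matrix_vector_scale: "A *v (c *s v) = c *s (A *v v)" for A :: "complex ^ 'n ^ 'm"
  by (rule vector_scalar_commute)

lemma hermitian_inner: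
  assumes "hermitian A"
  shows "u \<bullet> (A *v w) = (A *v u) \<bullet> w"
proof -
  have A: "cnj (A $ i $ j) = A $ j $ i" for i j
    using assms by (metis (no_types) hermitian_def ctranspose_def vec_lambda_beta)
  have "cinner u (A *v w) = (\<Sum>i\<in>UNIV. \<Sum>j\<in>UNIV. cnj (u $ i) * (A $ i $ j * w $ j))"
    by (simp add: cinner_def matrix_vector_mult_def sum_distrib_left)
  also have "\<dots> = (\<Sum>j\<in>UNIV. \<Sum>i\<in>UNIV. cnj (u $ i) * (A $ i $ j * w $ j))"
    by (rule sum.swap)
  also have "\<dots> = cinner (A *v u) w"
    by (simp add: cinner_def matrix_vector_mult_def sum_distrib_left cnj_sum A mult_ac)
  finally show ?thesis by (simp add: inner_eq_Re_cinner)
qed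

lemma hermitian_outer_add: "hermitian D \<Longrightarrow> hermitian (outer z z + D)"
  by (simp add: hermitian_def ctranspose_def outer_def vec_eq_iff mult.commute)

lemma norm_matrix_vector_le:
  fixes A :: "complex ^ 'n ^ 'm"
  assumes "onorm (\<lambda>v. A *v v) \<le> K"
  shows "norm (A *v v) \<le> K * norm v"
  by (rule order_trans[OF onorm[OF matrix_vector_mul_bounded_linear]])
    (simp add: assms mult_right_mono)

lemma abs_inner_matrix_le:
  fixes A :: "complex ^ 'n ^ 'n"
  assumes "onorm (\<lambda>v. A *v v) \<le> K"
  shows "\<bar>v \<bullet> (A *v v)\<bar> \<le> K * (norm v)\<^sup>2"
proof -
  have "\<bar>v \<bullet> (A *v v)\<bar> \<le> norm v * norm (A *v v)"
    by (rule Cauchy_Schwarz_ineq2)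
  also have "\<dots> \<le> norm v * (K * norm v)"
    by (intro mult_left_mono norm_matrix_vector_le assms) simp
  finally show ?thesis by (simp add: power2_eq_square mult_ac)
qed

section \<open>The torus and the certificate matrix\<close>

lemma inner_self_sum: "v \<bullet> v = (\<Sum>i\<in>UNIV. (cmod (v $ i))\<^sup>2)" for v :: "complex ^ 'n"
  by (simp add: inner_vec_def dot_square_norm)

lemma torus_norm_sq: "x \<in> torus \<Longrightarrow> (norm x)\<^sup>2 = real CARD('n)" for x :: "complex ^ 'n"
  by (simp add: power2_norm_eq_inner inner_self_sum torus_def)

lemma torus_cinner_self: "x \<in> torus \<Longrightarrow> cinner x x = of_nat CARD('n)" for x :: "complex ^ 'n"
  by (simp add: cinner_def torus_def mult.commute[of "cnj _"] flip: complex_norm_square)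

lemma torus_scale: "x \<in> torus \<Longrightarrow> cmod c = 1 \<Longrightarrow> c *s x \<in> torus"
  by (simp add: torus_def norm_mult)

lemma S_mat_mult_vec:
  "(S_mat C x *v v) $ i = complex_of_real (Re ((C *v x) $ i * cnj (x $ i))) * v $ i - (C *v v) $ i"
proof -
  define r where "r = complex_of_real (Re ((C *v x) $ i * cnj (x $ i)))"
  have "S_mat C x $ i $ j * v $ j = (if i = j then r * v $ j else 0) - C $ i $ j * v $ j" for j
    by (simp only: S_mat_nth left_diff_distrib r_def[symmetric]) simp
  then have "(S_mat C x *v v) $ i = r * v $ i - (C *v v) $ i"
    by (simp add: matrix_vector_mult_def sum_subtractf)
  then show ?thesis by (simp only: r_def)
qed

lemma hermitian_S_mat: "hermitian C \<Longrightarrow> hermitian (S_mat C x)"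
  unfolding hermitian_def by (simp add: vec_eq_iff ctranspose_def S_mat_nth)

lemma inner_S_mat:
  "v \<bullet> (S_mat C x *v v) =
    (\<Sum>i\<in>UNIV. Re ((C *v x) $ i * cnj (x $ i)) * (cmod (v $ i))\<^sup>2) - v \<bullet> (C *v v)"
proof -
  have "v $ i \<bullet> (complex_of_real r * v $ i) = r * (cmod (v $ i))\<^sup>2" for r i
    by (simp add: dot_square_norm scaleR_conv_of_real[symmetric])
  then show ?thesis
    by (simp only: inner_vec_def[of v] S_mat_mult_vec inner_diff_right sum_subtractf)
qed

text \<open>On the torus the diagonal part of \<open>S_mat C x\<close> contributes the same amount at every point,
namely \<open>x\<^sup>* C x\<close>, so the quadratic form measures the loss in objective value.\<close>

lemma inner_S_mat_torus:
  assumes "y \<in> torus"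
  shows "y \<bullet> (S_mat C x *v y) = objective C x - objective C y"
proof -
  have "objective C x = (\<Sum>i\<in>UNIV. Re ((C *v x) $ i * cnj (x $ i)))"
    by (simp add: objective_def cinner_def mult_ac)
  then show ?thesis
    using assms by (simp add: inner_S_mat objective_inner[of C y] torus_def)
qed

text \<open>The components along \<open>x\<close> lie in the kernel of the Hermitian matrix \<open>S_mat C x\<close>, so
the gap between the values at \<open>x\<close> and \<open>y\<close> depends only on the part of \<open>y\<close>
orthogonal to \<open>x\<close>.\<close>

lemma strict_certificate:
  fixes x y :: "complex ^ 'n"
  assumes herm: "hermitian C" and x: "x \<in> torus" and y: "y \<in> torus"
    and Sx: "S_mat C x *v x = 0"
    and pos: "\<And>u. cinner x u = 0 \<Longrightarrow> u \<noteq> 0 \<Longrightarrow> 0 < u \<bullet> (S_mat C x *v u)"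
  shows "objective C y \<le> objective C x"
    and "objective C y = objective C x \<Longrightarrow> \<exists>c. cmod c = 1 \<and> y = c *s x"
proof -
  define a where "a = cinner x y / of_nat CARD('n)"
  define u where "u = y - a *s x"
  let ?S = "S_mat C x"
  have ortho: "cinner x u = 0"
    using x by (simp add: u_def a_def cinner_diff_right cinner_scale_right torus_cinner_self)
  have Sax: "?S *v (a *s x) = 0"
    by (simp add: matrix_vector_scale Sx)
  have y_eq: "y = a *s x + u" by (simp add: u_def)
  have "y \<bullet> (?S *v y) = y \<bullet> (?S *v u)"
    by (simp add: y_eq matrix_vector_right_distrib Sax)
  also have "\<dots> = (?S *v y) \<bullet> u"
    by (rule hermitian_inner[OF hermitian_S_mat[OF herm]])
  also have "\<dots> = u \<bullet> (?S *v u)"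
    by (simp add: y_eq matrix_vector_right_distrib Sax inner_commute)
  finally have gap: "objective C x - objective C y = u \<bullet> (?S *v u)"
    by (simp add: inner_S_mat_torus y)
  show "objective C y \<le> objective C x"
    using gap pos[OF ortho] by (cases "u = 0") auto
  assume "objective C y = objective C x"
  then have "u = 0" using gap pos[OF ortho] by auto
  then have ya: "y = a *s x" by (simp add: u_def)
  obtain i :: 'n where True by simp
  have "cmod (y $ i) = cmod a * cmod (x $ i)" by (simp add: ya norm_mult)
  then have "cmod a = 1" using x y by (simp add: torus_def)
  with ya show "\<exists>c. cmod c = 1 \<and> y = c *s x" by blast
qed

section \<open>First-order points correlated with the signal\<close>

text \<open>The phase of \<open>m z + d\<close> deviates from \<open>z\<close> by at most \<open>2 |d| / m\<close>: replacing the
modulus \<open>l\<close> of this number by \<open>m\<close> costs no more than the perturbation \<open>d\<close> itself.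
The sign condition on \<open>l\<close> excludes the opposite phase.\<close>

lemma unit_distance_le:
  fixes x z d :: complex
  assumes "cmod x = 1" "cmod z = 1" "0 \<le> l" "0 \<le> m"
    and eq: "of_real l * x = of_real m * z + d"
  shows "m * cmod (x - z) \<le> 2 * cmod d"
proof -
  have "\<bar>l - m\<bar> = \<bar>cmod (of_real l * x) - cmod (of_real m * z)\<bar>"
    using assms(1-4) by (simp add: norm_mult)
  also have "\<dots> \<le> cmod (of_real l * x - of_real m * z)" by (rule norm_triangle_ineq3)
  also have "\<dots> = cmod d" by (simp add: eq)
  finally have lm: "\<bar>l - m\<bar> \<le> cmod d" .
  have "of_real m * (x - z) = d - of_real (l - m) * x"
    using eq by (simp add: algebra_simps)
  then have "m * cmod (x - z) = cmod (d - of_real (l - m) * x)"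
    using assms(4) by (metis abs_of_nonneg norm_mult norm_of_real)
  also have "\<dots> \<le> cmod d + \<bar>l - m\<bar>"
    by (rule order_trans[OF norm_triangle_ineq4]) (simp only: norm_mult norm_of_real assms mult_1_right)
  finally show ?thesis using lm by simp
qed

text \<open>The crude correlation \<open>m \<ge> n/2\<close> improves itself: through the first-order condition it
bounds \<open>\<parallel>x - z\<parallel>\<close>, which determines \<open>m\<close> and controls both \<open>\<Delta> x\<close> entrywise and
\<open>z\<^sup>* u\<close> for \<open>u\<close> orthogonal to \<open>x\<close>.  The hypothesis on \<open>K\<^sup>2\<close> is the one that
keeps the entries of \<open>\<Delta> (x - z)\<close>, of size up to \<open>4 K\<^sup>2 / sqrt n\<close>, below a small
multiple of \<open>n\<close>.\<close>

lemma aligned_first_order_imp_certificate: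
  fixes z x :: "complex ^ 'n" and \<Delta> :: "complex ^ 'n ^ 'n" and m K :: real
  defines "n \<equiv> real CARD('n)"
  assumes z: "z \<in> torus" and x: "x \<in> torus"
    and C: "C = outer z z + \<Delta>"
    and aligned: "cinner z x = of_real m" and m: "n / 2 \<le> m"
    and K: "onorm (\<lambda>v. \<Delta> *v v) \<le> K" and K1: "K \<le> n / 14" and K2: "K\<^sup>2 \<le> n * sqrt n / 196"
    and \<Delta>z: "\<And>i. cmod ((\<Delta> *v z) $ i) \<le> n / 7"
    and Sx: "S_mat C x *v x = 0" and nonneg: "\<And>i. 0 \<le> Re ((C *v x) $ i * cnj (x $ i))"
    and u: "cinner x u = 0" "u \<noteq> 0"
  shows "0 < u \<bullet> (S_mat C x *v u)"
proof -
  define l where "l i = Re ((C *v x) $ i * cnj (x $ i))" for i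
  define D where "D = norm (x - z)"
  have n: "n > 0" by (simp add: n_def)
  have K0: "0 \<le> K" using K onorm_pos_le[of "\<lambda>v. \<Delta> *v v"] by simp
  have D0: "0 \<le> D" by (simp add: D_def)
  have Cx: "(C *v x) $ i = of_real m * z $ i + (\<Delta> *v x) $ i" for i
    by (simp add: C matrix_vector_mult_add_rdistrib outer_mult_vec aligned)
  have lx: "of_real (l i) * x $ i = of_real m * z $ i + (\<Delta> *v x) $ i" for i
    using arg_cong[OF Sx, of "\<lambda>v. v $ i"] by (simp add: S_mat_mult_vec l_def flip: Cx)
  have "norm (m *\<^sub>R (x - z)) \<le> norm (2 *\<^sub>R (\<Delta> *v x))"
  proof (rule norm_le_componentwise_cart)
    fix i
    have "m * cmod (x $ i - z $ i) \<le> 2 * cmod ((\<Delta> *v x) $ i)"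
      by (rule unit_distance_le[OF _ _ _ _ lx]) (use x z nonneg m n in \<open>auto simp: torus_def l_def\<close>)
    then show "norm ((m *\<^sub>R (x - z)) $ i) \<le> norm ((2 *\<^sub>R (\<Delta> *v x)) $ i)"
      using m n by simp
  qed
  then have "m * D \<le> 2 * norm (\<Delta> *v x)" using m n by (simp add: D_def)
  also have "norm (\<Delta> *v x) \<le> K * norm x" by (rule norm_matrix_vector_le[OF K])
  also have "norm x = sqrt n" using torus_norm_sq[OF x] by (simp add: n_def real_sqrt_unique)
  finally have "m * D \<le> 2 * (K * sqrt n)" by simp
  moreover have "n / 2 * D \<le> m * D" using m D0 by (rule mult_right_mono)
  ultimately have "n * D \<le> 4 * (K * sqrt n)" by linarith
  moreover have "n * D = sqrt n * (sqrt n * D)" using n by (simp flip: mult.assoc)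
  ultimately have "sqrt n * (sqrt n * D) \<le> sqrt n * (4 * K)" by (simp only: mult_ac)
  then have DK: "sqrt n * D \<le> 4 * K" using n by simp
  have "n * D\<^sup>2 = (sqrt n * D)\<^sup>2" using n by (simp add: power_mult_distrib)
  also have "\<dots> \<le> (4 * (n / 14))\<^sup>2" using DK K1 n D0 by (intro power_mono) auto
  also have "\<dots> = n * (4 * n / 49)" by (simp add: power2_eq_square)
  finally have D2: "D\<^sup>2 \<le> 4 * n / 49" using n by simp
  have "sqrt n * (K * D) \<le> K * (4 * K)" using mult_left_mono[OF DK K0] by (simp add: mult_ac)
  also have "\<dots> \<le> sqrt n * (n / 49)" using K2 by (simp add: power2_eq_square mult_ac)
  finally have KD: "K * D \<le> n / 49" using n by simp
  \<comment> \<open>Unit entries and \<open>z\<^sup>* x = m\<close> turn the polarization of \<open>\<parallel>x - z\<parallel>\<^sup>2\<close> into a formula for \<open>m\<close>.\<close>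
  have m_eq: "m = n - D\<^sup>2 / 2"
  proof -
    have "D\<^sup>2 = (norm x)\<^sup>2 + (norm z)\<^sup>2 - 2 * (z \<bullet> x)"
      by (simp add: D_def power2_norm_eq_inner inner_diff_left inner_diff_right inner_commute)
    then have "D\<^sup>2 = n + n - 2 * m"
      using x z by (simp add: torus_norm_sq n_def inner_eq_Re_cinner aligned)
    then show ?thesis by linarith
  qed
  have l_ge: "m - n / 7 - n / 49 \<le> l i" for i
  proof -
    have "(\<Delta> *v x) $ i = (\<Delta> *v z) $ i + (\<Delta> *v (x - z)) $ i"
      by (simp add: matrix_vector_mult_diff_distrib)
    moreover have "cmod ((\<Delta> *v (x - z)) $ i) \<le> K * D"
      unfolding D_def
      by (rule order_trans[OF Finite_Cartesian_Product.norm_nth_le norm_matrix_vector_le[OF K]])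
    ultimately have *: "cmod ((\<Delta> *v x) $ i) \<le> n / 7 + n / 49"
      using \<Delta>z[of i] KD norm_triangle_ineq[of "(\<Delta> *v z) $ i" "(\<Delta> *v (x - z)) $ i"] by simp
    have "0 \<le> l i" using nonneg by (simp only: l_def)
    then have "l i = cmod (of_real (l i) * x $ i)"
      using x by (simp add: norm_mult torus_def)
    then have "m - cmod ((\<Delta> *v x) $ i) \<le> l i"
      using norm_diff_ineq[of "of_real m * z $ i" "(\<Delta> *v x) $ i"] z m n
      by (simp add: lx norm_mult torus_def)
    with * show ?thesis by simp
  qed
  have "(m - n / 7 - n / 49) * (norm u)\<^sup>2 \<le> (\<Sum>i\<in>UNIV. l i * (cmod (u $ i))\<^sup>2)"
    unfolding power2_norm_eq_inner inner_self_sum sum_distrib_left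
    by (intro sum_mono mult_right_mono l_ge) simp
  moreover have "(cmod (cinner z u))\<^sup>2 \<le> 4 * n / 49 * (norm u)\<^sup>2"
  proof -
    have "cinner (x - z) u = - cinner z u" by (simp add: cinner_diff_left u)
    then have "cmod (cinner z u) \<le> D * norm u"
      using cinner_Cauchy_Schwarz[of "x - z" u] by (simp add: D_def)
    then have "(cmod (cinner z u))\<^sup>2 \<le> D\<^sup>2 * (norm u)\<^sup>2"
      by (metis norm_ge_zero power_mono power_mult_distrib)
    also have "\<dots> \<le> 4 * n / 49 * (norm u)\<^sup>2" using D2 by (rule mult_right_mono) simp
    finally show ?thesis .
  qed
  moreover have "u \<bullet> (\<Delta> *v u) \<le> n / 14 * (norm u)\<^sup>2"
    using abs_inner_matrix_le[OF K, of u] mult_right_mono[OF K1, of "(norm u)\<^sup>2"] by simp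
  moreover have "u \<bullet> (C *v u) = (cmod (cinner z u))\<^sup>2 + u \<bullet> (\<Delta> *v u)"
    by (simp add: C matrix_vector_mult_add_rdistrib inner_add_right inner_outer)
  ultimately have
    "(m - n / 7 - n / 49 - 4 * n / 49 - n / 14) * (norm u)\<^sup>2 \<le> u \<bullet> (S_mat C x *v u)"
    by (simp add: inner_S_mat l_def algebra_simps)
  moreover have "0 < (m - n / 7 - n / 49 - 4 * n / 49 - n / 14) * (norm u)\<^sup>2"
    using D2 n u by (intro mult_pos_pos) (auto simp: m_eq)
  ultimately show ?thesis by linarith
qed

text \<open>Multiplying \<open>z\<close> by a phase leaves \<open>C\<close> and the moduli of the entries of \<open>\<Delta> z\<close>
unchanged, and it can be chosen to make \<open>z\<^sup>* x\<close> a nonnegative real number.\<close>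

lemma first_order_imp_certificate:
  fixes z x :: "complex ^ 'n" and \<Delta> :: "complex ^ 'n ^ 'n" and K :: real
  defines "n \<equiv> real CARD('n)"
  assumes z: "z \<in> torus" and x: "x \<in> torus"
    and C: "C = outer z z + \<Delta>"
    and corr: "n / 2 \<le> cmod (cinner z x)"
    and K: "onorm (\<lambda>v. \<Delta> *v v) \<le> K" and K1: "K \<le> n / 14" and K2: "K\<^sup>2 \<le> n * sqrt n / 196"
    and \<Delta>z: "\<And>i. cmod ((\<Delta> *v z) $ i) \<le> n / 7"
    and Sx: "S_mat C x *v x = 0" and nonneg: "\<And>i. 0 \<le> Re ((C *v x) $ i * cnj (x $ i))"
    and u: "cinner x u = 0" "u \<noteq> 0"
  shows "0 < u \<bullet> (S_mat C x *v u)"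
proof -
  define c where "c = sgn (cinner z x)"
  have n: "n > 0" by (simp add: n_def)
  then have "cinner z x \<noteq> 0" using corr by auto
  then have c: "cmod c = 1" by (simp add: c_def norm_sgn)
  have cc: "c * cnj c = 1" by (simp add: c flip: complex_norm_square)
  have C': "C = outer (c *s z) (c *s z) + \<Delta>"
  proof -
    have "c * a * (cnj c * b) = a * b" for a b
      using cc by (metis mult.assoc mult.commute mult_1)
    then show ?thesis by (simp only: C outer_def vector_smult_component complex_cnj_mult)
  qed
  have "cinner (c *s z) x = cnj c * (c * of_real (cmod (cinner z x)))"
    by (simp add: cinner_scale_left c_def sgn_eq)
  then have al: "cinner (c *s z) x = of_real (cmod (cinner z x))"
    using cc by (simp add: mult_ac)
  show ?thesis
  proof (rule aligned_first_order_imp_certificate[OF torus_scale[OF z c] x C' al])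
    show "cmod ((\<Delta> *v (c *s z)) $ i) \<le> real CARD('n) / 7" for i
      using \<Delta>z[of i] by (simp add: matrix_vector_scale norm_mult c n_def)
  qed (use corr K K1 K2 Sx nonneg u in \<open>simp_all add: n_def\<close>)
qed

section \<open>Second-order critical points\<close>

text \<open>Moving only the coordinate \<open>x\<^sub>i\<close> along its circle shows that the diagonal entries of
\<open>S_mat C x\<close> are nonnegative; adding \<open>C\<^sub>i\<^sub>i\<close> keeps them so.\<close>

lemma second_order_critical_nonneg:
  assumes soc: "second_order_critical C x" and diag: "C $ i $ i \<in> \<real>\<^sub>\<ge>\<^sub>0"
  shows "0 \<le> Re ((C *v x) $ i * cnj (x $ i))"
proof -
  define v where "v = axis i (\<i> * x $ i)"
  have xi: "cmod (x $ i) = 1" using soc by (simp add: second_order_critical_def torus_def)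
  have xx: "x $ i * cnj (x $ i) = 1" using xi by (simp flip: complex_norm_square)
  have "v \<in> tangent_space x"
    using xx by (auto simp: tangent_space_def v_def axis_def mult.assoc)
  then have "0 \<le> v \<bullet> (S_mat C x *v v)"
    using soc by (simp add: second_order_critical_def)
  also have "\<dots> = Re (cnj (\<i> * x $ i) * (S_mat C x *v v) $ i)"
    by (simp add: v_def inner_axis' inner_complex_def)
  also have "(S_mat C x *v v) $ i = S_mat C x $ i $ i * (\<i> * x $ i)"
    by (simp add: matrix_vector_mult_def v_def axis_def if_distrib cong: if_cong)
  also have "cnj (\<i> * x $ i) * (S_mat C x $ i $ i * (\<i> * x $ i)) = S_mat C x $ i $ i"
    using xx by (simp add: mult_ac)
  finally have "Re (C $ i $ i) \<le> Re ((C *v x) $ i * cnj (x $ i))"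
    by (simp add: S_mat_nth)
  moreover have "0 \<le> Re (C $ i $ i)" using diag by (auto simp: nonneg_Reals_def)
  ultimately show ?thesis by simp
qed

text \<open>The quadratic form of \<open>S_mat C x\<close> on \<open>z - p\<close> and on \<open>\<i> (z + p)\<close> adds up
to twice the sum of its values at \<open>z\<close> and \<open>p\<close> by the parallelogram law, since a factor \<open>\<i>\<close> does not
change it.\<close>

lemma second_order_critical_two_point:
  assumes soc: "second_order_critical C x" and z: "z \<in> torus"
  shows "\<exists>p\<in>torus. objective C z + objective C p \<le> 2 * objective C x"
proof -
  \<comment> \<open>Reflection of each \<open>z\<^sub>i\<close> in the real line spanned by \<open>x\<^sub>i\<close>.\<close>
  define p where "p = (\<chi> i. cnj (z $ i) * (x $ i)\<^sup>2)"
  define v where "v = z - p"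
  define w where "w = \<i> *s (z + p)"
  let ?S = "S_mat C x"
  have x: "x \<in> torus" using soc by (simp add: second_order_critical_def)
  have p: "p \<in> torus" using x z by (simp add: torus_def p_def norm_mult norm_power)
  have px: "p $ i * cnj (x $ i) = cnj (z $ i * cnj (x $ i))" for i
  proof -
    have "x $ i * cnj (x $ i) = 1" using x by (simp add: torus_def flip: complex_norm_square)
    then show ?thesis by (simp add: p_def power2_eq_square mult.assoc)
  qed
  have "v \<in> tangent_space x"
    by (simp only: tangent_space_def v_def mem_Collect_eq vector_minus_component
        left_diff_distrib px) simp
  moreover have "w \<in> tangent_space x"
    by (simp only: tangent_space_def w_def mem_Collect_eq vector_smult_component
        vector_add_component distrib_right distrib_left mult.assoc px) simp
  ultimately have "0 \<le> v \<bullet> (?S *v v) + w \<bullet> (?S *v w)"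
    using soc by (simp add: second_order_critical_def)
  also have "w \<bullet> (?S *v w) = (z + p) \<bullet> (?S *v (z + p))"
    unfolding w_def matrix_vector_scale inner_eq_Re_cinner cinner_scale_left cinner_scale_right
    by simp
  also have "v \<bullet> (?S *v v) + (z + p) \<bullet> (?S *v (z + p)) = 2 * (z \<bullet> (?S *v z) + p \<bullet> (?S *v p))"
    by (simp add: v_def matrix_vector_right_distrib matrix_vector_mult_diff_distrib
        inner_add_left inner_add_right inner_diff_left inner_diff_right)
  finally show ?thesis using p by (intro bexI[of _ p]) (simp_all add: inner_S_mat_torus z)
qed

section \<open>Global optima\<close>

lemma objective_outer_add: "objective (outer z z + \<Delta>) x = (cmod (cinner z x))\<^sup>2 + objective \<Delta> x"
  by (simp add: objective_inner matrix_vector_mult_add_rdistrib inner_add_right inner_outer)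

lemma abs_objective_le:
  fixes \<Delta> :: "complex ^ 'n ^ 'n"
  assumes "onorm (\<lambda>v. \<Delta> *v v) \<le> K" "x \<in> torus"
  shows "\<bar>objective \<Delta> x\<bar> \<le> K * real CARD('n)"
  using abs_inner_matrix_le[OF assms(1), of x] by (simp add: objective_inner torus_norm_sq assms)

text \<open>As a function of the single coordinate \<open>x\<^sub>i\<close> on the unit circle, the objective is affine:
the diagonal entry contributes a constant.  Its maximum aligns \<open>x\<^sub>i\<close> with
\<open>b = (C x)\<^sub>i - C\<^sub>i\<^sub>i x\<^sub>i\<close>, the contribution of the other coordinates, and putting
\<open>C\<^sub>i\<^sub>i x\<^sub>i\<close> back preserves the direction.\<close>

lemma global_optimum_first_order:
  assumes herm: "hermitian C" and opt: "global_optimum C x" and diag: "C $ i $ i \<in> \<real>\<^sub>\<ge>\<^sub>0"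
  obtains l where "0 \<le> l" "(C *v x) $ i = complex_of_real l * x $ i"
proof -
  obtain a where a: "C $ i $ i = of_real a" "0 \<le> a"
    using diag by (auto simp: nonneg_Reals_def)
  define b where "b = (C *v x) $ i - of_real a * x $ i"
  have x: "x \<in> torus" using opt by (simp add: global_optimum_def)
  have xi: "cmod (x $ i) = 1" using x by (simp add: torus_def)
  have xx: "x $ i * cnj (x $ i) = 1" using xi by (simp flip: complex_norm_square)
  have key: "Re (cnj c * b) \<le> Re (cnj (x $ i) * b)" if c: "cmod c = 1" for c
  proof -
    define e where "e = axis i (c - x $ i)"
    have "x + e \<in> torus" using x c by (auto simp: torus_def e_def axis_def)
    then have "objective C (x + e) \<le> objective C x"
      using opt by (simp add: global_optimum_def)
    moreover have "objective C (x + e) = objective C x + 2 * (e \<bullet> (C *v x)) + e \<bullet> (C *v e)"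
      using hermitian_inner[OF herm, of x e]
      by (simp add: objective_inner matrix_vector_right_distrib inner_add_left inner_add_right
          inner_commute)
    moreover have "e \<bullet> (C *v x) = Re (cnj (c - x $ i) * (C *v x) $ i)"
      by (simp add: e_def inner_axis' inner_complex_def algebra_simps)
    moreover have "e \<bullet> (C *v e) = a * (2 - 2 * Re (cnj c * x $ i))"
    proof -
      have "(C *v e) $ i = of_real a * (c - x $ i)"
        by (simp add: matrix_vector_mult_def e_def axis_def if_distrib a cong: if_cong)
      moreover have "e \<bullet> (C *v e) = Re (cnj (c - x $ i) * (C *v e) $ i)"
        unfolding e_def inner_axis' by (simp add: inner_complex_def algebra_simps)
      ultimately have "e \<bullet> (C *v e) = Re (of_real a * ((c - x $ i) * cnj (c - x $ i)))"
        by (simp only: mult_ac)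
      also have "(c - x $ i) * cnj (c - x $ i)
          = c * cnj c + x $ i * cnj (x $ i) - (cnj c * x $ i + cnj (cnj c * x $ i))"
        by (simp add: algebra_simps)
      also have "c * cnj c = 1" using c by (simp flip: complex_norm_square)
      finally show ?thesis by (simp add: xx algebra_simps)
    qed
    moreover have "Re (cnj (c - x $ i) * (C *v x) $ i)
        = Re (cnj (c - x $ i) * b) + a * (Re (cnj c * x $ i) - 1)"
    proof -
      have "cnj (c - x $ i) * (C *v x) $ i
          = cnj (c - x $ i) * b + of_real a * (cnj c * x $ i - x $ i * cnj (x $ i))"
        by (simp add: b_def algebra_simps)
      then show ?thesis unfolding xx by simp
    qed
    ultimately have "Re (cnj (c - x $ i) * b) \<le> 0" by (simp add: algebra_simps)
    then show ?thesis by (simp add: left_diff_distrib)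
  qed
  have bx: "b = of_real (cmod b) * x $ i"
  proof (cases "b = 0")
    case False
    have "cnj (sgn b) * b = of_real (cmod b)"
      using False by (simp add: sgn_eq complex_norm_square[symmetric] mult.commute[of "cnj b"]
          power2_eq_square)
    then have "cmod b \<le> Re (cnj (x $ i) * b)"
      using key[of "sgn b"] False by (simp add: norm_sgn)
    moreover have norm_xb: "cmod (cnj (x $ i) * b) = cmod b" by (simp add: norm_mult xi)
    ultimately have Re_xb: "Re (cnj (x $ i) * b) = cmod b"
      using complex_Re_le_cmod[of "cnj (x $ i) * b"] by linarith
    then have "Im (cnj (x $ i) * b) = 0"
      using cmod_power2[of "cnj (x $ i) * b"] unfolding norm_xb by simp
    then have "cnj (x $ i) * b = of_real (cmod b)"
      using Re_xb by (intro complex_eqI) (simp_all only: Re_complex_of_real Im_complex_of_real)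
    then have "x $ i * cnj (x $ i) * b = of_real (cmod b) * x $ i"
      by (simp only: mult.assoc) (simp only: mult.commute)
    then show ?thesis by (simp only: xx mult_1)
  qed simp
  show thesis
  proof
    show "0 \<le> cmod b + a" using a by simp
    show "(C *v x) $ i = complex_of_real (cmod b + a) * x $ i"
      using bx by (simp add: b_def algebra_simps)
  qed
qed

section \<open>Second-order points below the noise level\<close>

text \<open>The noise levels of the theorem, as multiples of the powers of \<open>n\<close> against which
\<open>first_order_imp_certificate\<close> compares them.  The logarithm is absorbed by
\<open>ln t \<le> t - 1\<close> at \<open>t = n powr (2/3)\<close>.\<close>

lemma noise_levels:
  fixes n :: real
  assumes "1 \<le> n"
  defines "K \<equiv> 1 / 14 * n powr (2 / 3)"
  shows "K \<le> n / 14" and "K\<^sup>2 \<le> n * sqrt n / 196" and "K * sqrt (ln n) \<le> n / 7"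
proof -
  have "n powr (2 / 3) \<le> n powr 1" using assms by (intro powr_mono) auto
  then show "K \<le> n / 14" using assms by (simp add: K_def)
  have "(n powr (2 / 3))\<^sup>2 = n powr (4 / 3)"
    by (simp add: power2_eq_square flip: powr_add)
  also have "\<dots> \<le> n powr (1 + 1 / 2)" using assms by (intro powr_mono) auto
  also have "\<dots> = n * sqrt n" using assms by (simp only: powr_add powr_half_sqrt) simp
  finally show "K\<^sup>2 \<le> n * sqrt n / 196" by (simp add: K_def power_mult_distrib power2_eq_square)
  have "2 / 3 * ln n = ln (n powr (2 / 3))" using assms by (simp add: ln_powr)
  also have "\<dots> \<le> n powr (2 / 3)" using assms ln_le_minus_one[of "n powr (2 / 3)"] by simp
  finally have "ln n \<le> 2\<^sup>2 * n powr (2 / 3)"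
    using powr_ge_zero[of n "2 / 3"] unfolding power2_eq_square by linarith
  also have "\<dots> = (2 * n powr (1 / 3))\<^sup>2"
    by (simp add: power2_eq_square flip: powr_add)
  finally have "sqrt (ln n) \<le> 2 * n powr (1 / 3)" by (simp add: real_le_lsqrt)
  then have "K * sqrt (ln n) \<le> K * (2 * n powr (1 / 3))"
    by (intro mult_left_mono) (simp_all add: K_def)
  also have "\<dots> = n powr (2 / 3 + 1 / 3) / 7" using powr_add[of n "2 / 3" "1 / 3"] by (simp add: K_def)
  finally show "K * sqrt (ln n) \<le> n / 7" using assms by simp
qed

theorem theorem4:
  fixes z :: "complex ^ 'n" and \<Delta> C :: "complex ^ 'n ^ 'n"
  assumes "z \<in> torus"
    and "hermitian \<Delta>"
    and "C = outer z z + \<Delta>"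
    and "\<forall>i. C $ i $ i \<in> \<real>\<^sub>\<ge>\<^sub>0"
    and "onorm (\<lambda>v. \<Delta> *v v) \<le> 1 / 14 * real CARD('n) powr (2 / 3)"
    and "max_norm (\<Delta> *v z) \<le> 1 / 14 * real CARD('n) powr (2 / 3) * sqrt (ln (real CARD('n)))"
  shows "(\<forall>x. second_order_critical C x \<longrightarrow> global_optimum C x) \<and>
    (\<forall>x y. global_optimum C x \<and> global_optimum C y \<longrightarrow>
      (\<exists>\<theta>::real. x = exp (\<i> * complex_of_real \<theta>) *s y))"
proof -
  define n where "n = real CARD('n)"
  define K where "K = 1 / 14 * n powr (2 / 3)"
  have n: "1 \<le> n" by (simp add: n_def Suc_le_eq)
  note noise = noise_levels[OF n, folded K_def]
  have K: "onorm (\<lambda>v. \<Delta> *v v) \<le> K" using assms(5) by (simp add: K_def n_def)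
  have herm: "hermitian C" using assms(2,3) hermitian_outer_add by simp
  have \<Delta>z: "cmod ((\<Delta> *v z) $ i) \<le> n / 7" for i
  proof -
    have "cmod ((\<Delta> *v z) $ i) \<le> max_norm (\<Delta> *v z)"
      unfolding max_norm_def by (rule Max_ge) auto
    also have "\<dots> \<le> K * sqrt (ln n)" using assms(6) by (simp add: K_def n_def)
    finally show ?thesis using noise(3) by simp
  qed
  have obj_C: "\<bar>objective C y - (cmod (cinner z y))\<^sup>2\<bar> \<le> n\<^sup>2 / 14" if "y \<in> torus" for y
  proof -
    have "\<bar>objective \<Delta> y\<bar> \<le> K * n" using abs_objective_le[OF K that] by (simp add: n_def)
    also have "\<dots> \<le> n / 14 * n" using noise(1) n by (intro mult_right_mono) auto
    finally show ?thesis by (simp add: assms(3) objective_outer_add power2_eq_square)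
  qed
  have "cmod (cinner z z) = n" by (simp add: torus_cinner_self assms(1) n_def)
  then have obj_z: "n\<^sup>2 - n\<^sup>2 / 14 \<le> objective C z"
    using obj_C[OF assms(1)] unfolding abs_le_iff by simp
  \<comment> \<open>The value bound reflects the weaker of the two sources: \<open>n\<^sup>2/2\<close> from the two-point
    inequality, minus \<open>n\<^sup>2/14\<close> for the noise at \<open>z\<close> and \<open>p\<close>. Removing the noise at \<open>x\<close>
    leaves \<open>m\<^sup>2 \<ge> 5 n\<^sup>2/14\<close>, which exceeds \<open>(n/2)\<^sup>2\<close>.\<close>
  have optimal: "objective C y \<le> objective C x"
    "objective C y = objective C x \<Longrightarrow> \<exists>c. cmod c = 1 \<and> y = c *s x"
    if x: "x \<in> torus" and y: "y \<in> torus"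
      and val: "n\<^sup>2 / 2 - n\<^sup>2 / 14 \<le> objective C x"
      and Sx: "S_mat C x *v x = 0" and nonneg: "\<And>i. 0 \<le> Re ((C *v x) $ i * cnj (x $ i))"
    for x y
  proof -
    have "(n / 2)\<^sup>2 \<le> (cmod (cinner z x))\<^sup>2"
      using val obj_C[OF x] zero_le_power2[of n] unfolding abs_le_iff
      by (simp add: power_divide)
    then have corr: "n / 2 \<le> cmod (cinner z x)" by (rule power2_le_imp_le) simp
    note pos = first_order_imp_certificate[OF assms(1) x assms(3) corr[unfolded n_def] K
        noise(1,2)[unfolded n_def] \<Delta>z[unfolded n_def] Sx nonneg]
    show "objective C y \<le> objective C x"
      by (rule strict_certificate(1)[OF herm x y Sx pos])
    show "\<exists>c. cmod c = 1 \<and> y = c *s x" if "objective C y = objective C x"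
      by (rule strict_certificate(2)[OF herm x y Sx pos that])
  qed
  have "global_optimum C x" if soc: "second_order_critical C x" for x
  proof -
    have x: "x \<in> torus" and Sx: "S_mat C x *v x = 0"
      using soc by (simp_all add: second_order_critical_def)
    obtain p where p: "p \<in> torus" "objective C z + objective C p \<le> 2 * objective C x"
      using second_order_critical_two_point[OF soc assms(1)] by blast
    have "- (n\<^sup>2 / 14) \<le> objective C p"
      using obj_C[OF p(1)] zero_le_power2[of "cmod (cinner z p)"] by linarith
    then have "n\<^sup>2 / 2 - n\<^sup>2 / 14 \<le> objective C x" using obj_z p(2) by simp
    then show ?thesis
      using optimal(1)[OF x _ _ Sx] second_order_critical_nonneg[OF soc] assms(4) x
      by (auto simp: global_optimum_def)
  qed
  moreover have "\<exists>\<theta>::real. x = exp (\<i> * complex_of_real \<theta>) *s y"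
    if x: "global_optimum C x" and y: "global_optimum C y" for x y
  proof -
    have t: "x \<in> torus" "y \<in> torus" using x y by (simp_all add: global_optimum_def)
    have yy: "y $ i * cnj (y $ i) = 1" for i
      using t by (simp add: torus_def flip: complex_norm_square)
    have "objective C z \<le> objective C y" using y assms(1) by (simp add: global_optimum_def)
    then have val: "n\<^sup>2 / 2 - n\<^sup>2 / 14 \<le> objective C y"
      using obj_z zero_le_power2[of n] by linarith
    have "0 \<le> Re ((C *v y) $ i * cnj (y $ i)) \<and> (S_mat C y *v y) $ i = 0" for i
    proof -
      obtain l where l: "0 \<le> l" "(C *v y) $ i = complex_of_real l * y $ i"
        using global_optimum_first_order[OF herm y] assms(4) by blast
      have "(C *v y) $ i * cnj (y $ i) = complex_of_real l"
        by (simp only: l(2) mult.assoc yy mult_1_right)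
      then show ?thesis
        using l by (simp only: S_mat_mult_vec Re_complex_of_real) simp
    qed
    then have nonneg: "\<And>i. 0 \<le> Re ((C *v y) $ i * cnj (y $ i))"
      and "\<And>i. (S_mat C y *v y) $ i = 0" by blast+
    then have Sy: "S_mat C y *v y = 0" by (simp add: vec_eq_iff)
    have "objective C x = objective C y" using x y t by (auto simp: global_optimum_def intro: antisym)
    then obtain c where c: "cmod c = 1" "x = c *s y"
      using optimal(2)[OF t(2,1) val Sy nonneg] by blast
    then have "c = exp (\<i> * complex_of_real (Arg c))"
      using Arg_eq[of c] by (cases "c = 0") auto
    with c(2) show ?thesis by metis
  qed
  ultimately show ?thesis by blast
qed

end
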